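(* Let $x^0\in\mathbb{R}^n$ be arbitrary, let $\underline f=\inf_{x\in\mathbb{R}^n}f(x)$, and assume that $\epsilon$ satisfies $$0<\epsilon<n\lambda\left[\frac{\sqrt{2L_f[F(x^0)+\epsilon-\underline f]}}{\lambda p}\right]^q .$$ Let $\{x^k\}$ be a sequence generated from $x^0$ by $$x^{k+1}\in\mathrm{Arg\,min}_{x\in\mathbb{R}^n}\left\{f(x)+\lambda p\sum_{i=1}^n s^k_i|x_i|\right\},\qquad s^k_i=\min\left\{\left(\frac{\epsilon}{\lambda n}\right)^{\frac1q},|x^k_i|^{\frac1{q-1}}\right\}\ \ \forall i,\qquad k\ge0.$$ Suppose that $x^*$ is an accumulation point of $\{x^k\}$. Then $x^*$ is a first-order stationary point of $\min_{x\in\mathbb{R}^n}\{F(x)=f(x)+\lambda\|x\|_p^p\}$, i.e., $x^*_i\,\partial f(x^* )/\partial x_i+\lambda p|x^*_i|^p=0$ for all $i$. Moreover, the nonzero entries of $x^*$ satisfy $$|x^*_i|\ge\left(\frac{\lambda p}{\sqrt{2L_f[F(x^0)+\epsilon-\underline f]}}\right)^{\frac1{1-p}}\quad\text{for all } i \text{ with } x^*_i\ne0.$$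
   Context: Here $\lambda>0$, $p\in(0,1)$, and $q$ is defined by $\frac1p+\frac1q=1$ (so $q<0$). Convention: $0^\beta=\infty$ for $\beta<0$. The function $f:\mathbb{R}^n\to\mathbb{R}$ is continuously differentiable, bounded below, with $L_f$-Lipschitz continuous gradient, $L_f>0$: $\|\nabla f(x)-\nabla f(y)\|_2\le L_f\|x-y\|_2$ for all $x,y$. $\|x\|_p^p=\sum_i|x_i|^p$. *)

theory Defs
  imports "HOL-Analysis.Analysis"
begin

definition partial_deriv :: "(real ^ 'n \<Rightarrow> real) \<Rightarrow> 'n::finite \<Rightarrow> real ^ 'n \<Rightarrow> real" where
  "partial_deriv f i x = deriv (\<lambda>t. f (x + t *\<^sub>R axis i 1)) 0"

definition grad :: "(real ^ 'n \<Rightarrow> real) \<Rightarrow> real ^ 'n \<Rightarrow> real ^ 'n::finite" where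
  "grad f x = (\<chi> i. partial_deriv f i x)"

definition continuously_differentiable :: "(real ^ 'n::finite \<Rightarrow> real) \<Rightarrow> bool" where
  "continuously_differentiable f \<longleftrightarrow>
     (\<forall>x. f differentiable (at x)) \<and> continuous_on UNIV (grad f)"

definition lp_pow :: "real \<Rightarrow> real ^ 'n::finite \<Rightarrow> real" where
  "lp_pow p x = (\<Sum>i\<in>UNIV. \<bar>x $ i\<bar> powr p)"

definition lp_objective ::
  "(real ^ 'n::finite \<Rightarrow> real) \<Rightarrow> real \<Rightarrow> real \<Rightarrow> real ^ 'n \<Rightarrow> real" where
  "lp_objective f lam p x = f x + lam * lp_pow p x"

definition lp_stationary ::
  "(real ^ 'n::finite \<Rightarrow> real) \<Rightarrow> real \<Rightarrow> real \<Rightarrow> real ^ 'n \<Rightarrow> bool" where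
  "lp_stationary f lam p x \<longleftrightarrow>
     (\<forall>i. x $ i * partial_deriv f i x + lam * p * \<bar>x $ i\<bar> powr p = 0)"

text \<open>
  The weights \<open>min {(eps / (lam n)) powr (1/q), |x_i| powr (1/(q-1))}\<close>, where \<open>q < 0\<close>.
  By convention \<open>0\<close> raised to a negative exponent is infinite, so the minimum at
  \<open>x_i = 0\<close> is the first argument; the case distinction is needed because
  \<open>0 powr a = 0\<close> in HOL.
\<close>
definition irl1_weights :: "real \<Rightarrow> real \<Rightarrow> real \<Rightarrow> real ^ 'n \<Rightarrow> real ^ 'n::finite" where
  "irl1_weights lam q eps x =
     (\<chi> i. let u = (eps / (lam * real CARD('n))) powr (1 / q)
           in if x $ i = 0 then u else min u (\<bar>x $ i\<bar> powr (1 / (q - 1))))"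

definition accumulation_point :: "(nat \<Rightarrow> 'a::topological_space) \<Rightarrow> 'a \<Rightarrow> bool" where
  "accumulation_point X l \<longleftrightarrow> (\<exists>r. strict_mono r \<and> (X \<circ> r) \<longlonglongrightarrow> l)"

end

theory Submission
  imports Defs
begin

text \<open>
  Writing \<open>c = (eps / (lam n)) powr (1 / p)\<close>, the weights are
  \<open>s i = max \<bar>x i\<bar> c powr (p - 1)\<close>, and up to a constant the subproblem objective is
  \<open>G y x = f y + lam * (\<Sum>i. p * \<bar>y i\<bar> * m i powr (p - 1) + (1 - p) * m i powr p)\<close>, where
  \<open>m i = max \<bar>x i\<bar> c\<close>. By concavity of \<open>a powr p\<close>, the choice \<open>m i = max \<bar>y i\<bar> c\<close> minimises
  this over all \<open>m i \<ge> c\<close>, so \<open>G y y \<le> G y x\<close> and the method is an alternating minimisation: the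
  values \<open>G (x k) (x k)\<close> decrease, and an accumulation point \<open>z\<close> minimises \<open>G \<cdot> z\<close>. The
  optimality condition reads \<open>\<bar>\<partial>\<^sub>i f z\<bar> = lam * p * s i\<close> wherever \<open>z i \<noteq> 0\<close>. The descent
  lemma bounds \<open>\<bar>\<partial>\<^sub>i f z\<bar>\<close> by the square root in the hypothesis on \<open>eps\<close>, which therefore says that
  the truncation at \<open>c\<close> is inactive there.
\<close>

section \<open>Tangent lines as majorants of the power function\<close>

definition lp_majorant :: "real \<Rightarrow> real \<Rightarrow> real \<Rightarrow> real" where
  "lp_majorant p a m = p * a * m powr (p - 1) + (1 - p) * m powr p"

lemma powr_minus_one_mult: "0 < (m::real) \<Longrightarrow> m * m powr (p - 1) = m powr p"
  by (simp add: powr_diff)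

lemma lp_majorant_nonneg:
  assumes "0 \<le> p" "p \<le> 1" "0 \<le> a"
  shows "0 \<le> lp_majorant p a m"
  using assms by (simp add: lp_majorant_def)

lemma lp_majorant_same: "0 < a \<Longrightarrow> lp_majorant p a a = a powr p"
  unfolding lp_majorant_def mult.assoc
  by (subst powr_minus_one_mult) (auto simp: algebra_simps)

text \<open>\<open>lp_majorant p a m\<close> is the value at \<open>a\<close> of the tangent to the
  concave function \<open>a powr p\<close> at \<open>m\<close>. That the tangent lies above the
  graph is the weighted Young inequality divided by \<open>m powr (1 - p)\<close>.\<close>

lemma powr_le_lp_majorant:
  assumes "0 \<le> p" "p \<le> 1" "0 < a" "0 < m"
  shows "a powr p \<le> lp_majorant p a m"
proof -
  have "a powr p * m powr (1 - p) \<le> p * a + (1 - p) * m"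
    using assms by (intro Youngs_inequality_0) auto
  then have "(a powr p * m powr (1 - p)) * m powr (p - 1) \<le> (p * a + (1 - p) * m) * m powr (p - 1)"
    by (intro mult_right_mono) auto
  moreover have "m powr (1 - p) * m powr (p - 1) = 1"
    using assms by (simp flip: powr_add)
  moreover have "m * (p * m powr (p - 1)) = p * m powr p"
    using assms powr_minus_one_mult[of m p] by simp
  ultimately show ?thesis
    using assms powr_minus_one_mult[of m p] by (simp add: lp_majorant_def algebra_simps)
qed

lemma lp_majorant_max_le:
  assumes "0 \<le> p" "p \<le> 1" "0 \<le> a" "0 < c" "c \<le> m"
  shows "lp_majorant p a (max a c) \<le> lp_majorant p a m"
proof (cases "c \<le> a")
  case True
  then show ?thesis
    using assms powr_le_lp_majorant[of p a m] by (simp add: lp_majorant_same max_def)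
next
  case False
  \<comment> \<open>For \<open>a < c\<close>, the majorant at \<open>a\<close> is the one at
    \<open>c\<close> minus \<open>p * (c - a) * m powr (p - 1)\<close>. Over
    \<open>m \<ge> c\<close>, the former is least and the subtracted term is largest at
    \<open>m = c\<close>.\<close>
  have "m powr (p - 1) \<le> c powr (p - 1)"
    using assms by (intro powr_mono2') auto
  then have "p * (c - a) * m powr (p - 1) \<le> p * (c - a) * c powr (p - 1)"
    using assms False by (intro mult_left_mono) auto
  moreover have "lp_majorant p c c \<le> lp_majorant p c m"
    using assms powr_le_lp_majorant[of p c m] by (simp add: lp_majorant_same)
  ultimately show ?thesis
    using False by (simp add: lp_majorant_def algebra_simps max_def)
qed

text \<open>Bounds the initial value of the decreasing objective: truncating at \<open>c\<close>
  costs at most \<open>c powr p\<close> in each coordinate, and these costs sum to the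
  \<open>eps\<close> in the theorem.\<close>

lemma lp_majorant_max_le_add:
  assumes "0 < p" "p \<le> 1" "0 \<le> a" "0 < c"
  shows "lp_majorant p a (max a c) \<le> a powr p + c powr p"
proof (cases "c \<le> a")
  case True
  then show ?thesis
    using assms by (simp add: lp_majorant_same max_def)
next
  case False
  have "a * c powr (p - 1) \<le> a powr p"
  proof (cases "a = 0")
    case False
    have "c powr (p - 1) \<le> a powr (p - 1)"
      using assms \<open>\<not> c \<le> a\<close> False by (intro powr_mono2') auto
    then have "a * c powr (p - 1) \<le> a * a powr (p - 1)"
      using assms by (intro mult_left_mono) auto
    then show ?thesis
      using assms False powr_minus_one_mult[of a p] by simp
  qed simp
  then have "p * (a * c powr (p - 1)) \<le> 1 * a powr p"
    using assms by (intro mult_mono) auto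
  moreover have "(1 - p) * c powr p \<le> 1 * c powr p"
    using assms by (intro mult_right_mono) auto
  ultimately show ?thesis
    using False by (simp add: lp_majorant_def max_def mult.assoc)
qed

lemma continuous_on_lp_majorant [continuous_intros]:
  assumes "continuous_on S g" "continuous_on S h" "\<And>z. z \<in> S \<Longrightarrow> h z \<noteq> 0"
  shows "continuous_on S (\<lambda>z. lp_majorant p (g z) (h z))"
  unfolding lp_majorant_def using assms by (intro continuous_intros) auto

section \<open>Conjugate exponents and the weights\<close>

lemma min_powr_minus_one:
  assumes "p < (1::real)" "0 < a" "0 < c"
  shows "min (c powr (p - 1)) (a powr (p - 1)) = max a c powr (p - 1)"
  using assms powr_mono2'[of "p - 1" a c] powr_mono2'[of "p - 1" c a]
  by (auto simp: max_def min_def)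

lemma conjugate_exponent:
  assumes "0 < p" "p < (1::real)" "1 / p + 1 / q = 1"
  shows "q < 0" "1 / (q - 1) = p - 1" "1 / q = 1 / p * (p - 1)"
proof -
  have "q \<noteq> 0"
    using assms by auto
  then have eq: "q * (p - 1) = p"
    using assms by (simp add: field_simps)
  then have q: "q = p / (p - 1)"
    using assms by (simp add: field_simps)
  show "q < 0"
    unfolding q using assms by (simp add: divide_pos_neg)
  have "q - 1 = 1 / (p - 1)"
    unfolding q using assms by (simp add: field_simps)
  then show "1 / (q - 1) = p - 1"
    by simp
  show "1 / q = 1 / p * (p - 1)"
    unfolding q by simp
qed

text \<open>Both arguments of the minimum are powers with the negative exponent
  \<open>p - 1\<close>, of \<open>c\<close> and of \<open>\<bar>x $ i\<bar>\<close>, so the minimum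
  of the powers is the power of the maximum. At \<open>x $ i = 0\<close> the maximum is
  \<open>c\<close>, which agrees with the case distinction in the definition.\<close>

lemma irl1_weights_nth:
  fixes x :: "real ^ 'n::finite"
  assumes "0 < p" "p < 1" "1 / p + 1 / q = 1" "0 < lam" "0 < eps"
  shows "irl1_weights lam q eps x $ i =
    max \<bar>x $ i\<bar> ((eps / (lam * real CARD('n))) powr (1 / p)) powr (p - 1)"
proof -
  let ?c = "(eps / (lam * real CARD('n))) powr (1 / p)"
  have c: "0 < ?c"
    using assms by simp
  have u: "(eps / (lam * real CARD('n))) powr (1 / q) = ?c powr (p - 1)"
    unfolding powr_powr conjugate_exponent(3)[OF assms(1-3)] ..
  show ?thesis
    using min_powr_minus_one[OF assms(2) _ c, of "\<bar>x $ i\<bar>"] c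
    by (simp add: irl1_weights_def Let_def u conjugate_exponent(2)[OF assms(1-3)])
qed

section \<open>Accumulation points of alternating minimisation\<close>

lemma alternating_minimization_accumulation_point:
  fixes G :: "'a::topological_space \<Rightarrow> 'a \<Rightarrow> real"
  assumes cont_diag: "continuous_on UNIV (\<lambda>z. G z z)"
    and cont: "\<And>y. continuous_on UNIV (G y)"
    and diag: "\<And>y z. G y y \<le> G y z"
    and step: "\<And>k y. G (x (Suc k)) (x k) \<le> G y (x k)"
    and acc: "accumulation_point x l"
  shows "G l l \<le> G y l" "G l l \<le> G (x 0) (x 0)"
proof -
  obtain r where r: "strict_mono r" "(\<lambda>j. x (r j)) \<longlonglongrightarrow> l"
    using acc by (auto simp: accumulation_point_def o_def)
  have Suc_le: "G (x (Suc k)) (x (Suc k)) \<le> G y (x k)" for k y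
    using diag step order_trans by blast
  then have dec: "decseq (\<lambda>k. G (x k) (x k))"
    by (intro decseq_SucI)
  have lim_diag: "(\<lambda>j. G (x (r j)) (x (r j))) \<longlonglongrightarrow> G l l"
    using continuous_on_tendsto_compose[OF cont_diag r(2)] by simp
  have lim: "(\<lambda>j. G y (x (r j))) \<longlonglongrightarrow> G y l"
    using continuous_on_tendsto_compose[OF cont r(2)] by simp
  \<comment> \<open>\<open>Suc_le\<close> compares consecutive iterates, but the limit needs
    consecutive terms of the subsequence. Monotonicity of the diagonal values bridges the gap from
    \<open>Suc (r j)\<close> to \<open>r (Suc j)\<close>.\<close>
  have "G (x (r (Suc j))) (x (r (Suc j))) \<le> G y (x (r j))" for j
  proof -
    have "Suc (r j) \<le> r (Suc j)"
      using r(1) by (simp add: strict_mono_Suc_iff Suc_le_eq)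
    then show ?thesis
      using decseqD[OF dec] Suc_le order_trans by blast
  qed
  then show "G l l \<le> G y l"
    using LIMSEQ_le[OF LIMSEQ_Suc[OF lim_diag] lim] by blast
  show "G l l \<le> G (x 0) (x 0)"
    using LIMSEQ_le_const2[OF lim_diag] decseqD[OF dec] by blast
qed

section \<open>Partial derivatives under a Lipschitz gradient\<close>

lemma DERIV_partial_deriv:
  fixes f :: "real ^ 'n::finite \<Rightarrow> real"
  assumes "\<And>y. f differentiable (at y)"
  shows "((\<lambda>t. f (x + t *\<^sub>R axis i 1)) has_real_derivative
    partial_deriv f i (x + t *\<^sub>R axis i 1)) (at t)"
proof -
  let ?y = "x + t *\<^sub>R axis i 1"
  have "(\<lambda>s. f (?y + s *\<^sub>R axis i 1)) differentiable (at 0)"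
    by (rule differentiable_compose[of f, OF assms]) (simp add: bounded_linear_imp_differentiable
      bounded_linear_scaleR_left)
  then have "((\<lambda>s. f (?y + s *\<^sub>R axis i 1)) has_real_derivative partial_deriv f i ?y) (at (t - t))"
    by (simp add: partial_deriv_def DERIV_deriv_iff_real_differentiable)
  then have "((\<lambda>s. f (?y + (s - t) *\<^sub>R axis i 1)) has_real_derivative partial_deriv f i ?y) (at t)"
    using DERIV_shift[of "\<lambda>s. f (?y + s *\<^sub>R axis i 1)" "partial_deriv f i ?y" t "- t"] by simp
  then show ?thesis
    by (simp add: algebra_simps)
qed

text \<open>The descent lemma on a line. After subtracting the quadratic, the derivative is
  nonpositive to the right of 0 and nonnegative to the left, so the difference is largest at
  0.\<close>

lemma quadratic_upper_bound:
  fixes \<phi> \<phi>' :: "real \<Rightarrow> real"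
  assumes deriv: "\<And>t. (\<phi> has_real_derivative \<phi>' t) (at t)"
    and lip: "\<And>t. \<bar>\<phi>' t - \<phi>' 0\<bar> \<le> L * \<bar>t\<bar>"
  shows "\<phi> t \<le> \<phi> 0 + \<phi>' 0 * t + L * t\<^sup>2 / 2"
proof -
  define g where "g = (\<lambda>t. \<phi> t - \<phi>' 0 * t - L * t\<^sup>2 / 2)"
  have g: "(g has_real_derivative \<phi>' t - \<phi>' 0 - L * t) (at t)" for t
    unfolding g_def by (auto intro!: derivative_eq_intros deriv)
  have "g t \<le> g 0"
  proof (cases "0 \<le> t")
    case True
    show ?thesis
    proof (rule DERIV_nonpos_imp_nonincreasing[OF True], intro exI conjI)
      fix s :: real assume "0 \<le> s"
      then show "\<phi>' s - \<phi>' 0 - L * s \<le> 0"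
        using lip[of s] by (simp add: abs_le_iff)
    qed (rule g)
  next
    case False
    then have "t \<le> 0"
      by simp
    then show ?thesis
    proof (rule DERIV_nonneg_imp_nondecreasing, intro exI conjI)
      fix s :: real assume "s \<le> 0"
      then show "0 \<le> \<phi>' s - \<phi>' 0 - L * s"
        using lip[of s] by (simp add: abs_le_iff)
    qed (rule g)
  qed
  then show ?thesis
    by (simp add: g_def)
qed

lemma partial_deriv_le_sqrt:
  fixes f :: "real ^ 'n::finite \<Rightarrow> real"
  assumes diff: "\<And>y. f differentiable (at y)"
    and L: "0 < L"
    and lip: "\<And>y z. norm (grad f y - grad f z) \<le> L * norm (y - z)"
    and low: "\<And>y. b \<le> f y"
  shows "\<bar>partial_deriv f i x\<bar> \<le> sqrt (2 * L * (f x - b))"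
proof -
  define d where "d = partial_deriv f i x"
  have "\<bar>partial_deriv f i (x + t *\<^sub>R axis i 1) - d\<bar> \<le> L * \<bar>t\<bar>" for t
    using component_le_norm_cart[of "grad f (x + t *\<^sub>R axis i 1) - grad f x" i]
      lip[of "x + t *\<^sub>R axis i 1" x]
    by (simp add: grad_def d_def)
  then have "f (x + t *\<^sub>R axis i 1) \<le> f x + d * t + L * t\<^sup>2 / 2" for t
    using quadratic_upper_bound[OF DERIV_partial_deriv[OF diff], of i x L] by (simp add: d_def)
  \<comment> \<open>\<open>- d / L\<close> minimises the quadratic bound; the guaranteed decrease
    \<open>d\<^sup>2 / (2 * L)\<close> cannot take \<open>f\<close> below \<open>b\<close>.\<close>
  from this[of "- d / L"] low[of "x + (- d / L) *\<^sub>R axis i 1"]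
  have "b \<le> f x + d * (- d / L) + L * (- d / L)\<^sup>2 / 2"
    by linarith
  also have "\<dots> = f x - d\<^sup>2 / (2 * L)"
    using L by (simp add: field_simps power2_eq_square)
  finally have "d\<^sup>2 \<le> 2 * L * (f x - b)"
    using L by (simp add: field_simps)
  then show ?thesis
    using real_sqrt_le_mono by (fastforce simp: d_def)
qed

section \<open>First-order condition for the weighted subproblem\<close>

lemma weighted_l1_minimizer_partial_deriv:
  fixes f :: "real ^ 'n::finite \<Rightarrow> real"
  assumes diff: "\<And>y. f differentiable (at y)"
    and min: "\<And>y. f z + (\<Sum>i\<in>UNIV. w i * \<bar>z $ i\<bar>) \<le> f y + (\<Sum>i\<in>UNIV. w i * \<bar>y $ i\<bar>)"
    and nz: "z $ i \<noteq> 0"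
  shows "partial_deriv f i z = - w i * sgn (z $ i)"
proof -
  define C where "C = (\<Sum>j\<in>UNIV - {i}. w j * \<bar>z $ j\<bar>)"
  define \<psi> where "\<psi> t = f (z + t *\<^sub>R axis i 1) + (w i * \<bar>z $ i + t\<bar> + C)" for t
  have "f (z + t *\<^sub>R axis i 1) + (\<Sum>j\<in>UNIV. w j * \<bar>(z + t *\<^sub>R axis i 1) $ j\<bar>) = \<psi> t" for t
    by (simp add: \<psi>_def C_def sum.remove[of UNIV i] axis_def)
  from this[of 0] this have "\<psi> 0 \<le> \<psi> t" for t
    using min[of "z + t *\<^sub>R axis i 1"] by simp
  \<comment> \<open>As long as \<open>\<bar>t\<bar> < \<bar>z $ i\<bar>\<close> the sign of
    \<open>z $ i + t\<close> is constant, so the absolute value is linear there. Hence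
    \<open>\<psi>\<close>, which moves only coordinate \<open>i\<close>, is differentiable at its
    minimum 0.\<close>
  moreover have "((\<lambda>t. \<bar>z $ i + t\<bar>) has_real_derivative sgn (z $ i)) (at 0)"
  proof (rule has_field_derivative_transform_within)
    show "((\<lambda>t. sgn (z $ i) * (z $ i + t)) has_real_derivative sgn (z $ i)) (at 0)"
      by (auto intro!: derivative_eq_intros)
    show "sgn (z $ i) * (z $ i + t) = \<bar>z $ i + t\<bar>" if "dist t 0 < \<bar>z $ i\<bar>" for t
      using that by (auto simp: sgn_if)
  qed (use nz in auto)
  then have "(\<psi> has_real_derivative partial_deriv f i z + w i * sgn (z $ i)) (at 0)"
    unfolding \<psi>_def
    using DERIV_partial_deriv[OF diff, of z i 0] by (auto intro!: derivative_eq_intros)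
  ultimately have "partial_deriv f i z + w i * sgn (z $ i) = 0"
    using DERIV_local_min[of \<psi> _ 0 1] by simp
  then show ?thesis
    by linarith
qed

section \<open>Stationarity of accumulation points and the bound on nonzero entries\<close>

theorem theorem4p1:
  fixes f :: "real ^ 'n::finite \<Rightarrow> real"
    and Lf lam p q eps flow :: real
    and x0 xstar :: "real ^ 'n"
    and x :: "nat \<Rightarrow> real ^ 'n"
  assumes lam_pos: "lam > 0"
    and p_range: "0 < p" "p < 1"
    and q_conj: "1 / p + 1 / q = 1"
    and f_C1: "continuously_differentiable f"
    and f_bdd: "bdd_below (range f)"
    and Lf_pos: "Lf > 0"
    and f_Lip: "\<forall>y z. norm (grad f y - grad f z) \<le> Lf * norm (y - z)"
    and flow_inf: "flow = (INF y. f y)"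
    and eps_pos: "0 < eps"
    and eps_less: "eps < real CARD('n) * lam *
          (sqrt (2 * Lf * (lp_objective f lam p x0 + eps - flow)) / (lam * p)) powr q"
    and x_init: "x 0 = x0"
    and x_step: "\<forall>k. is_arg_min
          (\<lambda>y. f y + lam * p * (\<Sum>i\<in>UNIV. irl1_weights lam q eps (x k) $ i * \<bar>y $ i\<bar>))
          (\<lambda>y. True) (x (Suc k))"
    and x_acc: "accumulation_point x xstar"
  shows "lp_stationary f lam p xstar \<and>
    (\<forall>i. xstar $ i \<noteq> 0 \<longrightarrow>
       \<bar>xstar $ i\<bar> \<ge> (lam * p / sqrt (2 * Lf * (lp_objective f lam p x0 + eps - flow)))
                        powr (1 / (1 - p)))"
proof -
  define c where "c = (eps / (lam * real CARD('n))) powr (1 / p)"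
  define R where "R = sqrt (2 * Lf * (lp_objective f lam p x0 + eps - flow))"
  define G where "G y z = f y + lam * (\<Sum>i\<in>UNIV. lp_majorant p \<bar>y $ i\<bar> (max \<bar>z $ i\<bar> c))"
    for y z
  define s where "s i = max \<bar>xstar $ i\<bar> c powr (p - 1)" for i
  have q: "q < 0"
    using conjugate_exponent(1) p_range q_conj .
  have c: "0 < c"
    using eps_pos lam_pos by (simp add: c_def)
  have c_powr: "c powr p = eps / (lam * real CARD('n))"
    using p_range eps_pos lam_pos by (simp add: c_def powr_powr)
  have diff: "f differentiable (at y)" for y
    using f_C1 by (simp add: continuously_differentiable_def)
  have cont_f: "continuous_on UNIV f"
    using diff by (simp add: continuous_at_imp_continuous_on differentiable_imp_continuous_within)
  have low: "flow \<le> f y" for y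
    unfolding flow_inf using f_bdd by (intro cINF_lower) auto

  \<comment> \<open>The last sum does not depend on \<open>y\<close>, and for \<open>z = x k\<close>
    the rest is the objective of the subproblem; so the two have the same minimisers in
    \<open>y\<close>.\<close>
  have G_weighted: "G y z = f y + (\<Sum>i\<in>UNIV. lam * p * max \<bar>z $ i\<bar> c powr (p - 1) * \<bar>y $ i\<bar>)
      + lam * (\<Sum>i\<in>UNIV. (1 - p) * max \<bar>z $ i\<bar> c powr p)" for y z
    by (simp add: G_def lp_majorant_def sum.distrib sum_distrib_left distrib_left mult_ac)
  have G_step: "G (x (Suc k)) (x k) \<le> G y (x k)" for k y
    using spec[OF x_step, of k]
    unfolding is_arg_min_linorder irl1_weights_nth[OF p_range q_conj lam_pos eps_pos]
      G_weighted c_def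
    by (simp add: sum_distrib_left mult.assoc)
  have G_diag: "G y y \<le> G y z" for y z
    unfolding G_def using p_range lam_pos c
    by (intro add_left_mono mult_left_mono sum_mono lp_majorant_max_le) auto
  have max_nz: "max \<bar>t\<bar> c \<noteq> 0" for t
    using c by linarith
  have cont_diag: "continuous_on UNIV (\<lambda>z. G z z)" and cont: "continuous_on UNIV (G y)" for y
    unfolding G_def using max_nz by (auto intro!: continuous_intros cont_f)
  have minimal: "G xstar xstar \<le> G y xstar"
    and descent: "G xstar xstar \<le> G x0 x0" for y
    using alternating_minimization_accumulation_point[OF cont_diag cont G_diag G_step x_acc] x_init
    by auto

  have "f xstar \<le> G xstar xstar"
    unfolding G_def using lam_pos p_range by (simp add: sum_nonneg lp_majorant_nonneg)
  moreover have "G x0 x0 \<le> f x0 + lam * (\<Sum>i\<in>UNIV. \<bar>x0 $ i\<bar> powr p + c powr p)"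
    unfolding G_def using p_range lam_pos c
    by (intro add_left_mono mult_left_mono sum_mono lp_majorant_max_le_add) auto
  \<comment> \<open>The truncation costs total \<open>lam * real CARD('n) * c powr p\<close>, which
    is \<open>eps\<close> by \<open>c_powr\<close>.\<close>
  moreover have "\<dots> = lp_objective f lam p x0 + eps"
    using lam_pos by (simp add: lp_objective_def lp_pow_def sum.distrib c_powr algebra_simps)
  ultimately have "f xstar \<le> lp_objective f lam p x0 + eps"
    using descent by linarith
  then have "sqrt (2 * Lf * (f xstar - flow)) \<le> R"
    unfolding R_def using Lf_pos by (intro real_sqrt_le_mono mult_left_mono) auto
  then have deriv_le: "\<bar>partial_deriv f i xstar\<bar> \<le> R" for i
    using partial_deriv_le_sqrt[OF diff Lf_pos _ low, of i xstar] f_Lip by force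

  have eps_less': "eps / (lam * real CARD('n)) < (R / (lam * p)) powr q"
    using eps_less lam_pos by (simp add: R_def field_simps)
  \<comment> \<open>In HOL \<open>0 powr q = 0\<close>, so a positive lower bound on this power
    excludes \<open>R = 0\<close>. Since \<open>sqrt\<close> of a negative number is negative,
    \<open>0 \<le> R\<close> is then read off from \<open>deriv_le\<close> at an arbitrary
    coordinate.\<close>
  then have "(R / (lam * p)) powr q \<noteq> 0"
    using eps_pos lam_pos by (smt (verit) divide_pos_pos mult_pos_pos of_nat_0_less_iff zero_less_card_finite)
  then have "R \<noteq> 0"
    by auto
  moreover have "0 \<le> R"
    using deriv_le[of undefined] by linarith
  ultimately have R: "0 < R / (lam * p)" "0 < R"
    using lam_pos p_range by auto
  \<comment> \<open>The exponent \<open>1 / q\<close> is negative and reverses the inequality: the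
    truncated weight \<open>c powr (p - 1)\<close> exceeds the bound that \<open>s_le\<close> puts
    on weights of nonzero entries.\<close>
  have "((R / (lam * p)) powr q) powr (1 / q) < (eps / (lam * real CARD('n))) powr (1 / q)"
    using eps_less' q eps_pos lam_pos by (intro powr_less_mono2_neg) auto
  moreover have "(eps / (lam * real CARD('n))) powr (1 / q) = c powr (p - 1)"
    unfolding c_def powr_powr conjugate_exponent(3)[OF p_range q_conj] ..
  ultimately have R_less: "R / (lam * p) < c powr (p - 1)"
    using q R p_range lam_pos by (simp add: powr_powr)

  have deriv: "partial_deriv f i xstar = - (lam * p * s i) * sgn (xstar $ i)"
    if "xstar $ i \<noteq> 0" for i
  proof (rule weighted_l1_minimizer_partial_deriv[OF diff _ that])
    show "f xstar + (\<Sum>i\<in>UNIV. lam * p * s i * \<bar>xstar $ i\<bar>)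
      \<le> f y + (\<Sum>i\<in>UNIV. lam * p * s i * \<bar>y $ i\<bar>)" for y
      using minimal[of y] by (simp add: G_weighted s_def)
  qed
  have s_le: "s i \<le> R / (lam * p)" if "xstar $ i \<noteq> 0" for i
  proof -
    have "\<bar>partial_deriv f i xstar\<bar> = lam * p * s i"
      using lam_pos p_range that by (simp add: deriv abs_mult s_def)
    then show ?thesis
      using deriv_le[of i] lam_pos p_range by (simp add: field_simps)
  qed
  have s_eq: "s i = \<bar>xstar $ i\<bar> powr (p - 1)" if "xstar $ i \<noteq> 0" for i
    using s_le[OF that] R_less by (auto simp: s_def max_def split: if_splits)

  have "xstar $ i * partial_deriv f i xstar + lam * p * \<bar>xstar $ i\<bar> powr p = 0" for i
  proof (cases "xstar $ i = 0")
    case False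
    have "xstar $ i * partial_deriv f i xstar
        = - (lam * p * (\<bar>xstar $ i\<bar> * \<bar>xstar $ i\<bar> powr (p - 1)))"
      using False by (simp add: deriv s_eq abs_sgn)
    also have "\<dots> = - (lam * p * \<bar>xstar $ i\<bar> powr p)"
      using False by (subst powr_minus_one_mult) auto
    finally show ?thesis
      by simp
  qed simp
  moreover have "(lam * p / R) powr (1 / (1 - p)) \<le> \<bar>xstar $ i\<bar>" if "xstar $ i \<noteq> 0" for i
  proof -
    \<comment> \<open>The negative power \<open>1 / (p - 1)\<close> inverts the weight and turns its
      upper bound into a lower bound on the entry.\<close>
    have "(R / (lam * p)) powr (1 / (p - 1)) \<le> (\<bar>xstar $ i\<bar> powr (p - 1)) powr (1 / (p - 1))"
      using s_le[OF that] that p_range unfolding s_eq[OF that]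
      by (intro powr_mono2') auto
    also have "\<dots> = \<bar>xstar $ i\<bar>"
      using that p_range by (simp add: powr_powr)
    finally have "(R / (lam * p)) powr - (1 / (1 - p)) \<le> \<bar>xstar $ i\<bar>"
      using minus_divide_right[of 1 "1 - p"] by simp
    moreover have "(R / (lam * p)) powr - (1 / (1 - p)) = (lam * p / R) powr (1 / (1 - p))"
      using R lam_pos p_range by (simp add: powr_minus powr_divide)
    ultimately show ?thesis
      by simp
  qed
  ultimately show ?thesis
    by (simp add: lp_stationary_def R_def)
qed

end
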